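(* Let $(X,d)$ be a metric space. The following statements are equivalent: (1) $(X,d)$ is Bourbaki-complete; (2) $(X,d)$ is sequentially Bourbaki-complete; (3) the closure of every $B\in\mathbf{BB}_d(X)$ is compact, that is, $\mathbf{BB}_d(X)=\mathbf{CB}(X)$; (4) $(X,d)$ is complete and $\mathbf{BB}_d(X)=\mathbf{TB}_d(X)$.
   Context: For a cover $\mathcal U$ of $X$ and $A\subset X$: $St(A,\mathcal U)=\bigcup\{U\in\mathcal U: U\cap A\neq\emptyset\}$, $St^0(A,\mathcal U)=A$, $St^m(A,\mathcal U)=St(St^{m-1}(A,\mathcal U),\mathcal U)$ for $m\geq 1$. For a metric space $(X,d)$ and $\varepsilon>0$ let $\mathcal B_\varepsilon=\{B_d(x,\varepsilon):x\in X\}$; the metric uniformity $\mu_d$ is the covering uniformity with base $\{\mathcal B_\varepsilon:\varepsilon>0\}$ (uniform covers are those refined by some $\mathcal B_\varepsilon$). For $x\in X$ and $m\ge 1$ put $B^m_d(x,\varepsilon)=St^{m-1}(B_d(x,\varepsilon),\mathcal B_\varepsilon)$. A filter $\mathcal F$ on $X$ is Bourbaki-Cauchy if for every $\mathcal U\in\mu_d$ there are $m\in\mathbb N$, $U\in\mathcal U$ and $F\in\mathcal F$ with $F\subset St^m(U,\mathcal U)$. $(X,d)$ is Bourbaki-complete if every Bourbaki-Cauchy filter has a cluster point. A sequence $(x_n)_n$ in $X$ is Bourbaki-Cauchy if for every $\mathcal U\in\mu_d$ there are $m,n_0\in\mathbb N$ and $U\in\mathcal U$ such that $x_n\in St^m(U,\mathcal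 U)$ for every $n\geq n_0$. $(X,d)$ is sequentially Bourbaki-complete if every Bourbaki-Cauchy sequence has a cluster point. $\mathbf{BB}_d(X)$ is the family of all Bourbaki-bounded subsets in $X$: those $B\subset X$ such that for every $\varepsilon>0$ there are $m\in\mathbb N$ and finitely many points $x_1,\dots,x_k\in X$ with $B\subset\bigcup_{i=1}^k B^m_d(x_i,\varepsilon)$. $\mathbf{TB}_d(X)$ is the family of all totally bounded subsets of $(X,d)$. $\mathbf{CB}(X)$ is the family of all subsets of $X$ whose closure in $X$ is compact. *)

theory Defs
  imports "HOL-Analysis.Analysis"
begin

definition star :: "'a set set \<Rightarrow> 'a set \<Rightarrow> 'a set" where
  "star \<U> A = \<Union>{U \<in> \<U>. U \<inter> A \<noteq> {}}"

abbreviation iterated_star :: "nat \<Rightarrow> 'a set set \<Rightarrow> 'a set \<Rightarrow> 'a set" where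
  "iterated_star m \<U> A \<equiv> (star \<U> ^^ m) A"

text \<open>A cluster point of a filter: every neighbourhood of \<open>x\<close> meets every member of the filter
  (\<open>frequently (\<lambda>y. y \<in> U) \<F>\<close> says that the complement of \<open>U\<close> contains no member of \<open>\<F>\<close>).\<close>

definition filter_cluster_point :: "'a topology \<Rightarrow> 'a filter \<Rightarrow> 'a \<Rightarrow> bool" where
  "filter_cluster_point X \<F> x \<longleftrightarrow>
     x \<in> topspace X \<and> (\<forall>U. openin X U \<and> x \<in> U \<longrightarrow> frequently (\<lambda>y. y \<in> U) \<F>)"

definition seq_cluster_point :: "'a topology \<Rightarrow> (nat \<Rightarrow> 'a) \<Rightarrow> 'a \<Rightarrow> bool" where
  "seq_cluster_point X \<sigma> x \<longleftrightarrow>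
     x \<in> topspace X \<and> (\<forall>U. openin X U \<and> x \<in> U \<longrightarrow> frequently (\<lambda>n. \<sigma> n \<in> U) sequentially)"

definition relatively_compact_sets :: "'a topology \<Rightarrow> 'a set set" where
  "relatively_compact_sets X = {B. B \<subseteq> topspace X \<and> compactin X (X closure_of B)}"

context Metric_space
begin

definition ball_cover :: "real \<Rightarrow> 'a set set" where
  "ball_cover \<epsilon> = {mball x \<epsilon> | x. x \<in> M}"

definition metric_uniformity :: "'a set set set" where
  "metric_uniformity =
     {\<U>. \<U> \<subseteq> Pow M \<and> \<Union>\<U> = M \<and> (\<exists>\<epsilon>>0. \<forall>B \<in> ball_cover \<epsilon>. \<exists>U \<in> \<U>. B \<subseteq> U)}"

text \<open>Only meant for \<open>m \<ge> 1\<close>.\<close>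

definition iterated_ball :: "nat \<Rightarrow> 'a \<Rightarrow> real \<Rightarrow> 'a set" where
  "iterated_ball m x \<epsilon> = iterated_star (m - 1) (ball_cover \<epsilon>) (mball x \<epsilon>)"

text \<open>A (proper) filter on \<open>M\<close> is a library filter on the ambient type that is different from
  \<open>bot\<close> and lies below \<open>principal M\<close>, that is, contains \<open>M\<close>; a set \<open>A\<close> is a member of \<open>\<F>\<close> iff
  \<open>eventually (\<lambda>x. x \<in> A) \<F>\<close>.\<close>

definition bourbaki_Cauchy_filter :: "'a filter \<Rightarrow> bool" where
  "bourbaki_Cauchy_filter \<F> \<longleftrightarrow>
     \<F> \<noteq> bot \<and> \<F> \<le> principal M \<and>
     (\<forall>\<U> \<in> metric_uniformity. \<exists>m. \<exists>U \<in> \<U>. \<exists>A.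
        eventually (\<lambda>x. x \<in> A) \<F> \<and> A \<subseteq> iterated_star m \<U> U)"

definition bourbaki_complete :: bool where
  "bourbaki_complete \<longleftrightarrow>
     (\<forall>\<F>. bourbaki_Cauchy_filter \<F> \<longrightarrow> (\<exists>x. filter_cluster_point mtopology \<F> x))"

definition bourbaki_Cauchy_seq :: "(nat \<Rightarrow> 'a) \<Rightarrow> bool" where
  "bourbaki_Cauchy_seq \<sigma> \<longleftrightarrow>
     range \<sigma> \<subseteq> M \<and>
     (\<forall>\<U> \<in> metric_uniformity. \<exists>m n\<^sub>0. \<exists>U \<in> \<U>. \<forall>n\<ge>n\<^sub>0. \<sigma> n \<in> iterated_star m \<U> U)"

definition sequentially_bourbaki_complete :: bool where
  "sequentially_bourbaki_complete \<longleftrightarrow>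
     (\<forall>\<sigma>. bourbaki_Cauchy_seq \<sigma> \<longrightarrow> (\<exists>x. seq_cluster_point mtopology \<sigma> x))"

definition bourbaki_bounded_sets :: "'a set set" where
  "bourbaki_bounded_sets =
     {B. B \<subseteq> M \<and> (\<forall>\<epsilon>>0. \<exists>m\<ge>1. \<exists>P. finite P \<and> P \<subseteq> M \<and> B \<subseteq> (\<Union>x\<in>P. iterated_ball m x \<epsilon>))}"

definition totally_bounded_sets :: "'a set set" where
  "totally_bounded_sets = {B. mtotally_bounded B}"

end

end

theory Submission
  imports Defs "HOL-Library.Diagonal_Subsequence"
begin

text \<open>
  Write \<open>BB\<close>, \<open>TB\<close> and \<open>CB\<close> for the Bourbaki-bounded, totally bounded and relatively compact sets.
  Sequential Bourbaki-completeness is the hub of the proof: it implies completeness with \<open>BB = TB\<close>,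
  this gives \<open>BB = CB\<close>, and compactness of the closures of the sets in \<open>BB\<close> leads back to it.

  Sequences and bounded sets are linked by two facts.  The range of a Bourbaki-Cauchy sequence is
  Bourbaki-bounded (\<open>bourbaki_Cauchy_seq_imp_bourbaki_bounded\<close>), because a tail lies in one
  iterated ball and the finitely many remaining terms can be added as centres.  Conversely, every
  sequence in a Bourbaki-bounded set has a Bourbaki-Cauchy subsequence
  (\<open>bourbaki_bounded_imp_bourbaki_Cauchy_subseq\<close>): at each scale the pigeonhole principle puts
  infinitely many terms into one iterated ball, and a diagonal subsequence serves all scales.

  In a sequentially Bourbaki-complete space, such a subsequence has a convergent, hence Cauchy,
  subsequence; this gives \<open>BB = TB\<close>, and completeness holds because Cauchy sequences are
  Bourbaki-Cauchy.  In a complete space \<open>TB = CB\<close>, and in every metric space \<open>CB\<close> is contained in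
  \<open>TB\<close>, hence in \<open>BB\<close>.  If the sets in \<open>BB\<close> have compact closure, then so does the range of a
  Bourbaki-Cauchy sequence, which therefore has a cluster point.

  Bourbaki-completeness implies its sequential form, since a sequence is Bourbaki-Cauchy exactly if
  the filter generated by its tails is, and both have the same cluster points.  The converse needs
  no ultrafilter.  If for some \<open>\<epsilon>\<close> no member of a Bourbaki-Cauchy filter were covered by finitely
  many \<open>\<epsilon>\<close>-balls, one could pick an \<open>\<epsilon>\<close>-separated sequence running through members that witness
  the Bourbaki-Cauchy property at smaller and smaller scales; it would be Bourbaki-Cauchy without a
  cluster point (\<open>bourbaki_Cauchy_filter_finite_ball_cover\<close>).  So the filter has members with
  finite covers by arbitrarily small balls, and one can choose a decreasing sequence of closed sets
  with radii tending to 0, each of which meets every member of the filter.  By completeness these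
  sets have a common point, and it is a cluster point of the filter
  (\<open>mcomplete_imp_filter_cluster_point\<close>).
\<close>

section \<open>Iterated stars and iterated balls\<close>

lemma star_mono:
  assumes "\<And>V. V \<in> \<V> \<Longrightarrow> \<exists>U \<in> \<U>. V \<subseteq> U" "A \<subseteq> B"
  shows "star \<V> A \<subseteq> star \<U> B"
  using assms unfolding star_def by (blast dest: assms(1))

lemma iterated_star_mono:
  assumes "\<And>V. V \<in> \<V> \<Longrightarrow> \<exists>U \<in> \<U>. V \<subseteq> U" "A \<subseteq> B"
  shows "iterated_star m \<V> A \<subseteq> iterated_star m \<U> B"
proof (induction m)
  case 0
  show ?case using assms(2) by simp
next
  case (Suc m)
  show ?case using star_mono[OF assms(1) Suc] by simp
qed

context Metric_space
begin

lemma iterated_ball_Suc: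
  "iterated_ball (Suc m) x \<epsilon> = iterated_star m (ball_cover \<epsilon>) (mball x \<epsilon>)"
  by (simp add: iterated_ball_def)

lemma ball_cover_in_metric_uniformity:
  assumes "\<epsilon> > 0"
  shows "ball_cover \<epsilon> \<in> metric_uniformity"
proof -
  have "ball_cover \<epsilon> \<subseteq> Pow M" "\<Union> (ball_cover \<epsilon>) \<subseteq> M"
    by (auto simp: ball_cover_def)
  moreover have "M \<subseteq> \<Union> (ball_cover \<epsilon>)"
    using assms centre_in_mball_iff unfolding ball_cover_def by blast
  ultimately show ?thesis
    using assms unfolding metric_uniformity_def by blast
qed

lemma centre_in_iterated_ball:
  assumes "\<epsilon> > 0" "x \<in> M"
  shows "x \<in> iterated_ball (Suc m) x \<epsilon>"
proof (induction m)
  case 0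
  show ?case using assms by (simp add: iterated_ball_Suc)
next
  case (Suc m)
  have "mball x \<epsilon> \<in> ball_cover \<epsilon>" using assms(2) by (auto simp: ball_cover_def)
  moreover have "x \<in> mball x \<epsilon>" using assms by simp
  ultimately show ?case
    using Suc by (simp add: iterated_ball_Suc star_def del: in_mball) blast
qed

text \<open>The radii \<open>1 / (n + 1)\<close> suffice to test a property of all uniform covers.\<close>

lemma metric_uniformity_refine:
  assumes "\<U> \<in> metric_uniformity"
  obtains n where "\<And>V. V \<in> ball_cover (inverse (real (Suc n))) \<Longrightarrow> \<exists>U \<in> \<U>. V \<subseteq> U"
proof -
  obtain \<epsilon> where \<epsilon>: "\<epsilon> > 0" "\<And>B. B \<in> ball_cover \<epsilon> \<Longrightarrow> \<exists>U \<in> \<U>. B \<subseteq> U"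
    using assms unfolding metric_uniformity_def by blast
  obtain n where n: "inverse (real (Suc n)) < \<epsilon>"
    using reals_Archimedean[OF \<epsilon>(1)] ..
  have "\<exists>U \<in> \<U>. V \<subseteq> U" if V: "V \<in> ball_cover (inverse (real (Suc n)))" for V
  proof -
    obtain x where x: "x \<in> M" "V = mball x (inverse (real (Suc n)))"
      using V by (auto simp: ball_cover_def)
    then have "V \<subseteq> mball x \<epsilon>" using n by (simp add: mball_subset_concentric)
    moreover have "mball x \<epsilon> \<in> ball_cover \<epsilon>" using x(1) by (auto simp: ball_cover_def)
    ultimately show ?thesis using \<epsilon>(2) by (meson subset_trans)
  qed
  then show thesis using that by blast
qed

section \<open>Bourbaki-Cauchy filters and sequences\<close>

lemma bourbaki_Cauchy_filterD:
  assumes "bourbaki_Cauchy_filter \<F>" "\<epsilon> > 0"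
  obtains m x where "x \<in> M" "eventually (\<lambda>y. y \<in> iterated_ball (Suc m) x \<epsilon>) \<F>"
proof -
  obtain m U A where *: "U \<in> ball_cover \<epsilon>" "eventually (\<lambda>x. x \<in> A) \<F>"
      "A \<subseteq> iterated_star m (ball_cover \<epsilon>) U"
    using assms ball_cover_in_metric_uniformity unfolding bourbaki_Cauchy_filter_def by blast
  then obtain x where "x \<in> M" "U = mball x \<epsilon>" by (auto simp: ball_cover_def)
  moreover have "eventually (\<lambda>y. y \<in> iterated_star m (ball_cover \<epsilon>) U) \<F>"
    using *(2) by (rule eventually_mono) (use *(3) in blast)
  ultimately show thesis
    using that[of x m] by (simp add: iterated_ball_Suc)
qed

lemma bourbaki_Cauchy_filterI:
  assumes "\<F> \<noteq> bot" "\<F> \<le> principal M"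
    and ball: "\<And>n. \<exists>x \<in> M. \<exists>m.
      eventually (\<lambda>y. y \<in> iterated_ball (Suc m) x (inverse (real (Suc n)))) \<F>"
  shows "bourbaki_Cauchy_filter \<F>"
  unfolding bourbaki_Cauchy_filter_def
proof (intro conjI ballI)
  fix \<U> assume "\<U> \<in> metric_uniformity"
  then obtain n where n: "\<And>V. V \<in> ball_cover (inverse (real (Suc n))) \<Longrightarrow> \<exists>U \<in> \<U>. V \<subseteq> U"
    using metric_uniformity_refine by blast
  obtain x m where x: "x \<in> M"
      and ev: "eventually (\<lambda>y. y \<in> iterated_ball (Suc m) x (inverse (real (Suc n)))) \<F>"
    using ball by blast
  have "mball x (inverse (real (Suc n))) \<in> ball_cover (inverse (real (Suc n)))"
    using x by (auto simp: ball_cover_def)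
  then obtain U where U: "U \<in> \<U>" "mball x (inverse (real (Suc n))) \<subseteq> U"
    using n by blast
  have "iterated_ball (Suc m) x (inverse (real (Suc n))) \<subseteq> iterated_star m \<U> U"
    unfolding iterated_ball_Suc by (rule iterated_star_mono[OF n U(2)])
  then show "\<exists>m. \<exists>U \<in> \<U>. \<exists>A. eventually (\<lambda>x. x \<in> A) \<F> \<and> A \<subseteq> iterated_star m \<U> U"
    using U(1) ev by blast
qed (use assms in auto)

lemma bourbaki_Cauchy_seq_iff_filter:
  "bourbaki_Cauchy_seq \<sigma> \<longleftrightarrow>
     range \<sigma> \<subseteq> M \<and> bourbaki_Cauchy_filter (filtermap \<sigma> sequentially)"
proof -
  have "(\<exists>A. eventually (\<lambda>x. x \<in> A) (filtermap \<sigma> sequentially) \<and> A \<subseteq> T) \<longleftrightarrow>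
        (\<exists>n\<^sub>0. \<forall>n\<ge>n\<^sub>0. \<sigma> n \<in> T)" for T
    unfolding eventually_filtermap eventually_sequentially by blast
  moreover have "filtermap \<sigma> sequentially \<le> principal M" if "range \<sigma> \<subseteq> M"
    using that by (simp add: le_principal eventually_filtermap range_subsetD)
  moreover have "filtermap \<sigma> sequentially \<noteq> bot"
    by (simp add: filtermap_bot_iff)
  ultimately show ?thesis
    unfolding bourbaki_Cauchy_seq_def bourbaki_Cauchy_filter_def by (simp; blast)
qed

lemma bourbaki_Cauchy_seqD:
  assumes "bourbaki_Cauchy_seq \<sigma>" "\<epsilon> > 0"
  obtains m x N where "x \<in> M" "\<And>k. k \<ge> N \<Longrightarrow> \<sigma> k \<in> iterated_ball (Suc m) x \<epsilon>"
proof -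
  have "bourbaki_Cauchy_filter (filtermap \<sigma> sequentially)"
    using assms(1) bourbaki_Cauchy_seq_iff_filter by blast
  from bourbaki_Cauchy_filterD[OF this assms(2)] that show thesis
    unfolding eventually_filtermap eventually_sequentially by metis
qed

lemma bourbaki_Cauchy_seqI:
  assumes "range \<sigma> \<subseteq> M"
    and "\<And>n. \<exists>x \<in> M. \<exists>m N. \<forall>k\<ge>N. \<sigma> k \<in> iterated_ball (Suc m) x (inverse (real (Suc n)))"
  shows "bourbaki_Cauchy_seq \<sigma>"
  unfolding bourbaki_Cauchy_seq_iff_filter
proof (intro conjI bourbaki_Cauchy_filterI)
  show "filtermap \<sigma> sequentially \<noteq> bot" by (simp add: filtermap_bot_iff)
  show "filtermap \<sigma> sequentially \<le> principal M"
    using assms(1) by (simp add: le_principal eventually_filtermap range_subsetD)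
qed (use assms in \<open>auto simp: eventually_filtermap eventually_sequentially\<close>)

lemma MCauchy_imp_bourbaki_Cauchy_seq:
  assumes "MCauchy \<sigma>"
  shows "bourbaki_Cauchy_seq \<sigma>"
proof (rule bourbaki_Cauchy_seqI)
  show M: "range \<sigma> \<subseteq> M" using assms by (simp add: MCauchy_def)
  fix n
  obtain N where "\<And>k l. k \<ge> N \<Longrightarrow> l \<ge> N \<Longrightarrow> d (\<sigma> k) (\<sigma> l) < inverse (real (Suc n))"
    using assms unfolding MCauchy_def
    by (metis inverse_positive_iff_positive of_nat_0_less_iff zero_less_Suc)
  then have "\<forall>k\<ge>N. \<sigma> k \<in> iterated_ball (Suc 0) (\<sigma> N) (inverse (real (Suc n)))"
    using M by (auto simp: iterated_ball_Suc)
  then show "\<exists>x \<in> M. \<exists>m N. \<forall>k\<ge>N. \<sigma> k \<in> iterated_ball (Suc m) x (inverse (real (Suc n)))"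
    using M by blast
qed

section \<open>Cluster points\<close>

lemma seq_cluster_point_imp_convergent_subseq:
  assumes "seq_cluster_point mtopology \<sigma> x" "range \<sigma> \<subseteq> M"
  obtains r where "strict_mono r" "limitin mtopology (\<sigma> \<circ> r) x sequentially"
proof -
  have x: "x \<in> M" using assms(1) by (simp add: seq_cluster_point_def)
  have fr: "\<exists>k>N. \<sigma> k \<in> mball x (inverse (real (Suc n)))" for n N
  proof -
    have "frequently (\<lambda>k. \<sigma> k \<in> mball x (inverse (real (Suc n)))) sequentially"
      using assms(1) x by (simp add: seq_cluster_point_def del: in_mball)
    then show ?thesis
      unfolding frequently_sequentially by (metis Suc_le_lessD)
  qed
  have "\<exists>r. \<forall>n. \<sigma> (r n) \<in> mball x (inverse (real (Suc n))) \<and> r n < r (Suc n)"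
    by (rule dependent_nat_choice) (use fr in blast)+
  then obtain r where r: "\<And>n. \<sigma> (r n) \<in> mball x (inverse (real (Suc n)))" "\<And>n. r n < r (Suc n)"
    by blast
  have "limitin mtopology (\<sigma> \<circ> r) x sequentially"
    unfolding limitin_metric
  proof (intro conjI x allI impI)
    fix \<epsilon> :: real assume "\<epsilon> > 0"
    then have "eventually (\<lambda>n. inverse (real (Suc n)) < \<epsilon>) sequentially"
      using LIMSEQ_inverse_real_of_nat order_tendstoD(2) by blast
    then show "eventually (\<lambda>n. (\<sigma> \<circ> r) n \<in> M \<and> d ((\<sigma> \<circ> r) n) x < \<epsilon>) sequentially"
    proof (rule eventually_mono)
      fix n assume "inverse (real (Suc n)) < \<epsilon>"
      then show "(\<sigma> \<circ> r) n \<in> M \<and> d ((\<sigma> \<circ> r) n) x < \<epsilon>"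
        using r(1)[of n] by (simp add: commute)
    qed
  qed
  moreover have "strict_mono r" using r(2) by (simp add: strict_mono_Suc_iff)
  ultimately show thesis using that by blast
qed

lemma convergent_subseq_imp_seq_cluster_point:
  assumes "strict_mono r" "limitin X (\<sigma> \<circ> r) x sequentially"
  shows "seq_cluster_point X \<sigma> x"
  unfolding seq_cluster_point_def
proof (intro conjI allI impI)
  show "x \<in> topspace X" using assms(2) by (rule limitin_topspace)
  fix U assume U: "openin X U \<and> x \<in> U"
  then obtain N where N: "\<And>n. n \<ge> N \<Longrightarrow> \<sigma> (r n) \<in> U"
    using assms(2) by (auto simp: limitin_sequentially)
  show "frequently (\<lambda>n. \<sigma> n \<in> U) sequentially"
    unfolding frequently_sequentially
  proof
    fix k
    have "k \<le> max k N" by simp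
    also have "\<dots> \<le> r (max k N)" using seq_suble[OF assms(1)] .
    finally have "k \<le> r (max k N)" .
    moreover have "\<sigma> (r (max k N)) \<in> U" using N by simp
    ultimately show "\<exists>n\<ge>k. \<sigma> n \<in> U" by blast
  qed
qed

lemma bourbaki_complete_imp_sequentially_bourbaki_complete:
  assumes "bourbaki_complete"
  shows "sequentially_bourbaki_complete"
  unfolding sequentially_bourbaki_complete_def
proof (intro allI impI)
  fix \<sigma> assume "bourbaki_Cauchy_seq \<sigma>"
  then obtain x where "filter_cluster_point mtopology (filtermap \<sigma> sequentially) x"
    using assms unfolding bourbaki_complete_def bourbaki_Cauchy_seq_iff_filter by blast
  then have "seq_cluster_point mtopology \<sigma> x"
    by (simp add: filter_cluster_point_def seq_cluster_point_def frequently_def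
        eventually_filtermap)
  then show "\<exists>x. seq_cluster_point mtopology \<sigma> x" ..
qed

section \<open>Bourbaki-bounded sets\<close>

lemma mtotally_bounded_imp_bourbaki_bounded:
  assumes "mtotally_bounded B"
  shows "B \<in> bourbaki_bounded_sets"
proof -
  have B: "B \<subseteq> M" using assms by (rule mtotally_bounded_imp_subset)
  have "\<exists>m\<ge>1. \<exists>P. finite P \<and> P \<subseteq> M \<and> B \<subseteq> (\<Union>x\<in>P. iterated_ball m x \<epsilon>)"
    if \<epsilon>: "\<epsilon> > 0" for \<epsilon>
  proof -
    obtain K where "finite K" "K \<subseteq> B" "B \<subseteq> (\<Union>x\<in>K. mball x \<epsilon>)"
      using assms[unfolded mtotally_bounded_def, rule_format, OF \<epsilon>] by metis
    then show ?thesis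
      using B by (intro exI[of _ 1] conjI exI[of _ K]) (auto simp: iterated_ball_def)
  qed
  then show ?thesis using B by (simp add: bourbaki_bounded_sets_def)
qed

lemma bourbaki_Cauchy_seq_imp_bourbaki_bounded:
  assumes "bourbaki_Cauchy_seq \<sigma>"
  shows "range \<sigma> \<in> bourbaki_bounded_sets"
proof -
  have M: "range \<sigma> \<subseteq> M" using assms by (simp add: bourbaki_Cauchy_seq_def)
  have "\<exists>m\<ge>1. \<exists>P. finite P \<and> P \<subseteq> M \<and> range \<sigma> \<subseteq> (\<Union>x\<in>P. iterated_ball m x \<epsilon>)"
    if \<epsilon>: "\<epsilon> > 0" for \<epsilon>
  proof -
    obtain m x N where x: "x \<in> M" and tail: "\<And>k. k \<ge> N \<Longrightarrow> \<sigma> k \<in> iterated_ball (Suc m) x \<epsilon>"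
      using bourbaki_Cauchy_seqD[OF assms \<epsilon>] by blast
    have "\<sigma> k \<in> (\<Union>y\<in>insert x (\<sigma> ` {..<N}). iterated_ball (Suc m) y \<epsilon>)" for k
    proof (cases "k < N")
      case True
      have "\<sigma> k \<in> iterated_ball (Suc m) (\<sigma> k) \<epsilon>"
        using centre_in_iterated_ball[OF \<epsilon>] M by blast
      then show ?thesis using True by blast
    qed (use tail in auto)
    then show ?thesis
      using x M by (intro exI[of _ "Suc m"] conjI exI[of _ "insert x (\<sigma> ` {..<N})"]) auto
  qed
  then show ?thesis using M by (simp add: bourbaki_bounded_sets_def)
qed

lemma bourbaki_bounded_imp_bourbaki_Cauchy_subseq:
  fixes \<sigma> :: "nat \<Rightarrow> 'a"
  assumes B: "B \<in> bourbaki_bounded_sets" and \<sigma>: "range \<sigma> \<subseteq> B"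
  obtains r where "strict_mono r" "bourbaki_Cauchy_seq (\<sigma> \<circ> r)"
proof -
  have M: "range \<sigma> \<subseteq> M" using B \<sigma> by (auto simp: bourbaki_bounded_sets_def)
  define P where "P = (\<lambda>n (s :: nat \<Rightarrow> nat). \<exists>x \<in> M. \<exists>m. \<forall>k.
    \<sigma> (s k) \<in> iterated_ball (Suc m) x (inverse (real (Suc n))))"
  interpret subseqs P
  proof
    fix n and s :: "nat \<Rightarrow> nat"
    obtain m K where K: "m \<ge> 1" "finite K" "K \<subseteq> M"
        "B \<subseteq> (\<Union>x\<in>K. iterated_ball m x (inverse (real (Suc n))))"
      using B by (auto simp: bourbaki_bounded_sets_def
          dest: spec[where x = "inverse (real (Suc n))"])
    then have "\<forall>k. \<exists>x \<in> K. \<sigma> (s k) \<in> iterated_ball m x (inverse (real (Suc n)))"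
      using \<sigma> by blast
    then have "\<exists>\<^sub>F k in sequentially. \<exists>x \<in> K. \<sigma> (s k) \<in> iterated_ball m x (inverse (real (Suc n)))"
      by (simp add: frequently_def)
    \<comment> \<open>One of the finitely many iterated balls contains infinitely many terms.\<close>
    then obtain x where x: "x \<in> K"
        "\<exists>\<^sub>F k in sequentially. \<sigma> (s k) \<in> iterated_ball m x (inverse (real (Suc n)))"
      by (auto dest!: frequently_bex_finite[OF K(2)])
    then have "infinite {k. \<sigma> (s k) \<in> iterated_ball m x (inverse (real (Suc n)))}"
      by (simp add: frequently_cofinite cofinite_eq_sequentially[symmetric])
    then obtain r :: "nat \<Rightarrow> nat" where r: "strict_mono r"
        "\<And>k. r k \<in> {k. \<sigma> (s k) \<in> iterated_ball m x (inverse (real (Suc n)))}"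
      using infinite_enumerate by blast
    moreover have "Suc (m - 1) = m" using K(1) by simp
    ultimately have "P n (s \<circ> r)"
      unfolding P_def using x(1) K(3) by (intro bexI[of _ x] exI[of _ "m - 1"]) auto
    then show "\<exists>r. strict_mono r \<and> P n (s \<circ> r)" using r(1) by blast
  qed
  have "P n (diagseq \<circ> (+) (Suc n))" for n
    by (rule diagseq_holds) (auto simp: P_def)
  then have tail: "\<exists>x \<in> M. \<exists>m. \<forall>k. \<sigma> (diagseq (Suc n + k)) \<in>
      iterated_ball (Suc m) x (inverse (real (Suc n)))" for n
    by (simp add: P_def)
  have "bourbaki_Cauchy_seq (\<sigma> \<circ> diagseq)"
  proof (rule bourbaki_Cauchy_seqI)
    show "range (\<sigma> \<circ> diagseq) \<subseteq> M" using M by auto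
    fix n
    obtain x m where x: "x \<in> M" "\<And>k. \<sigma> (diagseq (Suc n + k)) \<in>
        iterated_ball (Suc m) x (inverse (real (Suc n)))"
      using tail by blast
    have "\<forall>k\<ge>Suc n. (\<sigma> \<circ> diagseq) k \<in> iterated_ball (Suc m) x (inverse (real (Suc n)))"
      using x(2) by (metis comp_apply le_add_diff_inverse)
    then show "\<exists>x \<in> M. \<exists>m N. \<forall>k\<ge>N.
        (\<sigma> \<circ> diagseq) k \<in> iterated_ball (Suc m) x (inverse (real (Suc n)))"
      using x(1) by blast
  qed
  then show thesis using that subseq_diagseq by blast
qed

lemma relatively_compact_imp_bourbaki_bounded:
  "relatively_compact_sets mtopology \<subseteq> bourbaki_bounded_sets"
  using compact_closure_of_imp_mtotally_bounded mtotally_bounded_imp_bourbaki_bounded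
  by (auto simp: relatively_compact_sets_def)

section \<open>Consequences of sequential Bourbaki-completeness\<close>

lemma sequentially_bourbaki_complete_imp_mcomplete:
  assumes "sequentially_bourbaki_complete"
  shows "mcomplete"
  unfolding mcomplete_def
proof (intro allI impI)
  fix \<sigma> assume \<sigma>: "MCauchy \<sigma>"
  then obtain x where "seq_cluster_point mtopology \<sigma> x"
    using assms MCauchy_imp_bourbaki_Cauchy_seq unfolding sequentially_bourbaki_complete_def
    by blast
  moreover have "range \<sigma> \<subseteq> M" using \<sigma> by (simp add: MCauchy_def)
  ultimately obtain r where "strict_mono r" "limitin mtopology (\<sigma> \<circ> r) x sequentially"
    by (rule seq_cluster_point_imp_convergent_subseq)
  then show "\<exists>x. limitin mtopology \<sigma> x sequentially"
    using MCauchy_convergent_subsequence[OF \<sigma>] by blast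
qed

lemma sequentially_bourbaki_complete_imp_totally_bounded:
  assumes "sequentially_bourbaki_complete"
  shows "bourbaki_bounded_sets = totally_bounded_sets"
proof
  show "totally_bounded_sets \<subseteq> bourbaki_bounded_sets"
    using mtotally_bounded_imp_bourbaki_bounded by (auto simp: totally_bounded_sets_def)
  show "bourbaki_bounded_sets \<subseteq> totally_bounded_sets"
  proof
    fix B assume B: "B \<in> bourbaki_bounded_sets"
    have "\<exists>r. strict_mono r \<and> MCauchy (\<sigma> \<circ> r)" if \<sigma>: "range \<sigma> \<subseteq> B" for \<sigma> :: "nat \<Rightarrow> 'a"
    proof -
      obtain r where r: "strict_mono r" "bourbaki_Cauchy_seq (\<sigma> \<circ> r)"
        using bourbaki_bounded_imp_bourbaki_Cauchy_subseq[OF B \<sigma>] by blast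
      then have M: "range (\<sigma> \<circ> r) \<subseteq> M" by (simp add: bourbaki_Cauchy_seq_def)
      obtain x where "seq_cluster_point mtopology (\<sigma> \<circ> r) x"
        using r(2) assms unfolding sequentially_bourbaki_complete_def by blast
      then obtain q where q: "strict_mono q" "limitin mtopology ((\<sigma> \<circ> r) \<circ> q) x sequentially"
        using M by (rule seq_cluster_point_imp_convergent_subseq)
      have "MCauchy ((\<sigma> \<circ> r) \<circ> q)"
        by (rule convergent_imp_MCauchy[OF _ q(2)]) (use M in auto)
      then show ?thesis
        using r(1) q(1) strict_mono_o by (metis comp_assoc)
    qed
    moreover have "B \<subseteq> M" using B by (simp add: bourbaki_bounded_sets_def)
    ultimately show "B \<in> totally_bounded_sets"
      by (simp add: totally_bounded_sets_def mtotally_bounded_sequentially)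
  qed
qed

lemma compact_closure_imp_sequentially_bourbaki_complete:
  assumes "\<forall>B \<in> bourbaki_bounded_sets. compactin mtopology (mtopology closure_of B)"
  shows "sequentially_bourbaki_complete"
  unfolding sequentially_bourbaki_complete_def
proof (intro allI impI)
  fix \<sigma> assume \<sigma>: "bourbaki_Cauchy_seq \<sigma>"
  then have "compactin mtopology (mtopology closure_of range \<sigma>)"
    using assms bourbaki_Cauchy_seq_imp_bourbaki_bounded by blast
  moreover have "range \<sigma> \<subseteq> mtopology closure_of range \<sigma>"
    using \<sigma> by (intro closure_of_subset) (simp add: bourbaki_Cauchy_seq_def)
  ultimately obtain x r where "strict_mono r" "limitin mtopology (\<sigma> \<circ> r) x sequentially"
    unfolding compactin_sequentially by blast
  then show "\<exists>x. seq_cluster_point mtopology \<sigma> x"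
    by (blast intro: convergent_subseq_imp_seq_cluster_point)
qed

section \<open>From sequences to filters\<close>

text \<open>A cluster point lets two different terms come closer to each other than \<open>\<epsilon>\<close>.\<close>

lemma separated_seq_no_cluster_point:
  assumes "\<epsilon> > 0" and sep: "\<And>k n. k < n \<Longrightarrow> d (\<sigma> k) (\<sigma> n) \<ge> \<epsilon>"
  shows "\<not> seq_cluster_point mtopology \<sigma> x"
proof
  assume cl: "seq_cluster_point mtopology \<sigma> x"
  then have x: "x \<in> M" by (simp add: seq_cluster_point_def)
  then have fr: "\<exists>\<^sub>F n in sequentially. \<sigma> n \<in> mball x (\<epsilon>/2)"
    using cl assms(1) by (simp add: seq_cluster_point_def del: in_mball)
  then obtain k where k: "\<sigma> k \<in> mball x (\<epsilon>/2)" unfolding frequently_sequentially by blast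
  obtain n where n: "n \<ge> Suc k" "\<sigma> n \<in> mball x (\<epsilon>/2)"
    using fr unfolding frequently_sequentially by blast
  have "d (\<sigma> k) (\<sigma> n) \<le> d (\<sigma> k) x + d x (\<sigma> n)"
    using k n x by (intro triangle) auto
  also have "\<dots> < \<epsilon>" using k n by (simp add: commute)
  finally show False using sep[of k n] n(1) by simp
qed

lemma bourbaki_Cauchy_filter_finite_ball_cover:
  assumes complete: "sequentially_bourbaki_complete"
    and \<F>: "bourbaki_Cauchy_filter \<F>" and "\<epsilon> > 0"
  shows "\<exists>K. finite K \<and> K \<subseteq> M \<and> eventually (\<lambda>y. y \<in> (\<Union>x\<in>K. mball x \<epsilon>)) \<F>"
proof (rule ccontr)
  assume "\<not> ?thesis"
  then have no_cover: "\<not> eventually (\<lambda>y. y \<in> (\<Union>x\<in>K. mball x \<epsilon>)) \<F>"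
    if "finite K" "K \<subseteq> M" for K using that by metis
  have "\<exists>x m. x \<in> M \<and>
      eventually (\<lambda>y. y \<in> iterated_ball (Suc m) x (inverse (real (Suc n)))) \<F>" for n
  proof -
    have "inverse (real (Suc n)) > 0" by simp
    from bourbaki_Cauchy_filterD[OF \<F> this] show ?thesis by metis
  qed
  then obtain c m where c: "\<And>n. c n \<in> M" and
      ev: "\<And>n. eventually (\<lambda>y. y \<in> iterated_ball (Suc (m n)) (c n) (inverse (real (Suc n)))) \<F>"
    by metis
  define G where "G = (\<lambda>n. {y \<in> M. \<forall>i\<le>n.
    y \<in> iterated_ball (Suc (m i)) (c i) (inverse (real (Suc i)))})"
  have G: "eventually (\<lambda>y. y \<in> G n) \<F>" for n
  proof -
    have "eventually (\<lambda>y. y \<in> M) \<F>"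
      using \<F> by (simp add: bourbaki_Cauchy_filter_def le_principal)
    moreover have "eventually (\<lambda>y. \<forall>i\<in>{..n}.
        y \<in> iterated_ball (Suc (m i)) (c i) (inverse (real (Suc i)))) \<F>"
      using ev by (intro eventually_ball_finite) auto
    ultimately show ?thesis
      by eventually_elim (auto simp: G_def)
  qed
  \<comment> \<open>The terms chosen so far are centres of finitely many balls, which cannot cover \<open>G n\<close>.\<close>
  have "\<exists>f. \<forall>n. f n \<in> G n \<and> (\<forall>k<n. d (f k) (f n) \<ge> \<epsilon>)"
  proof (rule dependent_wellorder_choice)
    fix n and f :: "nat \<Rightarrow> 'a"
    assume IH: "\<And>k. k < n \<Longrightarrow> f k \<in> G k \<and> (\<forall>l<k. d (f l) (f k) \<ge> \<epsilon>)"
    then have M: "f ` {..<n} \<subseteq> M" by (auto simp: G_def)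
    have "\<exists>y. y \<in> G n \<and> y \<notin> (\<Union>x\<in>f ` {..<n}. mball x \<epsilon>)"
    proof (rule ccontr)
      assume "\<not> ?thesis"
      then have "eventually (\<lambda>y. y \<in> (\<Union>x\<in>f ` {..<n}. mball x \<epsilon>)) \<F>"
        by (intro eventually_mono[OF G[of n]]) blast
      then show False using no_cover[OF _ M] by simp
    qed
    then obtain y where y: "y \<in> G n" "y \<notin> (\<Union>x\<in>f ` {..<n}. mball x \<epsilon>)" by blast
    then have "\<forall>k<n. d (f k) y \<ge> \<epsilon>"
      using M by (fastforce simp: G_def)
    then show "\<exists>y. y \<in> G n \<and> (\<forall>k<n. d (f k) y \<ge> \<epsilon>)" using y(1) by blast
  qed auto
  then obtain f where f: "\<And>n. f n \<in> G n" "\<And>k n. k < n \<Longrightarrow> d (f k) (f n) \<ge> \<epsilon>" by blast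
  have "bourbaki_Cauchy_seq f"
  proof (rule bourbaki_Cauchy_seqI)
    show "range f \<subseteq> M" using f(1) by (auto simp: G_def)
    fix n
    have "\<forall>k\<ge>n. f k \<in> iterated_ball (Suc (m n)) (c n) (inverse (real (Suc n)))"
      using f(1) by (simp add: G_def)
    then show "\<exists>x \<in> M. \<exists>m N. \<forall>k\<ge>N. f k \<in> iterated_ball (Suc m) x (inverse (real (Suc n)))"
      using c by blast
  qed
  then show False
    using complete separated_seq_no_cluster_point[OF \<open>\<epsilon> > 0\<close>] f(2)
    unfolding sequentially_bourbaki_complete_def by blast
qed

text \<open>The filter itself need not be Cauchy; the sets \<open>E n\<close> in the proof only meet all its members,
  and are obtained by choosing at each scale one ball of a finite cover.\<close>

lemma mcomplete_imp_filter_cluster_point: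
  assumes "mcomplete" "\<F> \<noteq> bot"
    and cover: "\<And>\<epsilon>. \<epsilon> > 0 \<Longrightarrow>
      \<exists>K. finite K \<and> K \<subseteq> M \<and> eventually (\<lambda>y. y \<in> (\<Union>x\<in>K. mball x \<epsilon>)) \<F>"
  shows "\<exists>x. filter_cluster_point mtopology \<F> x"
proof -
  have step: "\<exists>E'. (closedin mtopology E' \<and> (\<exists>\<^sub>F y in \<F>. y \<in> E') \<and>
      (\<exists>a. E' \<subseteq> mcball a (inverse (real (Suc n))))) \<and> E' \<subseteq> E"
    if E: "closedin mtopology E" "\<exists>\<^sub>F y in \<F>. y \<in> E" for E n
  proof -
    let ?e = "inverse (real (Suc n))"
    obtain K where K: "finite K" "K \<subseteq> M" "eventually (\<lambda>y. y \<in> (\<Union>x\<in>K. mball x ?e)) \<F>"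
      using cover[of ?e] by auto
    then have "\<exists>\<^sub>F y in \<F>. \<exists>x\<in>K. y \<in> E \<and> y \<in> mball x ?e"
      using frequently_eventually_conj[OF E(2) K(3)] by (auto elim!: frequently_elim1)
    from frequently_bex_finite[OF K(1) this]
    obtain x where x: "x \<in> K" "\<exists>\<^sub>F y in \<F>. y \<in> E \<and> y \<in> mball x ?e"
      by (rule bexE)
    then have "\<exists>\<^sub>F y in \<F>. y \<in> E \<inter> mcball x ?e"
      by (auto elim!: frequently_elim1)
    moreover have "closedin mtopology (E \<inter> mcball x ?e)"
      using E(1) closedin_mcball by blast
    ultimately show ?thesis by blast
  qed
  have "\<exists>E. \<forall>n. (closedin mtopology (E n) \<and> (\<exists>\<^sub>F y in \<F>. y \<in> E n) \<and>
      (\<exists>a. E n \<subseteq> mcball a (inverse (real (Suc n))))) \<and> E (Suc n) \<subseteq> E n"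
  proof (rule dependent_nat_choice)
    have "eventually (\<lambda>y. y \<in> M) \<F>"
      using cover[of 1] by (auto elim!: eventually_mono)
    then have "\<exists>\<^sub>F y in \<F>. y \<in> M"
      using assms(2) eventually_frequently by blast
    moreover have "closedin mtopology M"
      using closedin_topspace[of mtopology] by simp
    ultimately show "\<exists>E. closedin mtopology E \<and> (\<exists>\<^sub>F y in \<F>. y \<in> E) \<and>
        (\<exists>a. E \<subseteq> mcball a (inverse (real (Suc 0))))"
      using step[of M 0] by blast
  qed (use step in blast)
  then obtain E where "\<forall>n. (closedin mtopology (E n) \<and> (\<exists>\<^sub>F y in \<F>. y \<in> E n) \<and>
      (\<exists>a. E n \<subseteq> mcball a (inverse (real (Suc n))))) \<and> E (Suc n) \<subseteq> E n" ..
  then have E: "\<And>n. closedin mtopology (E n)" "\<And>n. \<exists>\<^sub>F y in \<F>. y \<in> E n"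
      "\<And>n. \<exists>a. E n \<subseteq> mcball a (inverse (real (Suc n)))" "\<And>n. E (Suc n) \<subseteq> E n"
    by simp_all
  have small: "\<exists>n a. E n \<subseteq> mcball a \<epsilon>" if \<epsilon>: "\<epsilon> > 0" for \<epsilon>
  proof -
    obtain n where "inverse (real (Suc n)) < \<epsilon>"
      using reals_Archimedean[OF \<epsilon>] ..
    then have "mcball a (inverse (real (Suc n))) \<subseteq> mcball a \<epsilon>" for a
      by (simp add: mcball_subset_concentric)
    then show ?thesis
      using E(3)[of n] by (meson subset_trans)
  qed
  have nonempty: "E n \<noteq> {}" for n
    using frequently_ex[OF E(2)[of n]] by blast
  have "decseq E" using E(4) by (rule decseq_SucI)
  then have "\<Inter> (range E) \<noteq> {}"
    by (intro mcomplete_nest[THEN iffD1, OF assms(1), rule_format] conjI)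
      (simp_all add: E(1) nonempty small)
  then obtain x where x: "\<And>n. x \<in> E n" by blast
  have "filter_cluster_point mtopology \<F> x"
    unfolding filter_cluster_point_def
  proof (intro conjI allI impI)
    show "x \<in> topspace mtopology" using E(1) x closedin_subset by blast
    fix U assume "openin mtopology U \<and> x \<in> U"
    then obtain r where r: "r > 0" "mball x r \<subseteq> U" by (auto simp: openin_mtopology)
    obtain n a where na: "E n \<subseteq> mcball a (r/3)" using small[of "r/3"] r(1) by auto
    have "E n \<subseteq> mball x r"
    proof -
      have "x \<in> mcball a (r/3)" using na x by blast
      then have "mcball a (r/3) \<subseteq> mball x r"
        using r(1) by (intro mcball_subset_mball) auto
      then show ?thesis using na by blast
    qed
    then show "\<exists>\<^sub>F y in \<F>. y \<in> U"
      using E(2)[of n] r(2) by (auto elim!: frequently_elim1)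
  qed
  then show ?thesis ..
qed

lemma sequentially_bourbaki_complete_imp_bourbaki_complete:
  assumes "sequentially_bourbaki_complete"
  shows "bourbaki_complete"
  unfolding bourbaki_complete_def
proof (intro allI impI)
  fix \<F> assume \<F>: "bourbaki_Cauchy_filter \<F>"
  have "\<F> \<noteq> bot" using \<F> by (simp add: bourbaki_Cauchy_filter_def)
  with sequentially_bourbaki_complete_imp_mcomplete[OF assms]
  show "\<exists>x. filter_cluster_point mtopology \<F> x"
    by (rule mcomplete_imp_filter_cluster_point)
      (rule bourbaki_Cauchy_filter_finite_ball_cover[OF assms \<F>])
qed

section \<open>The equivalence\<close>

lemma totally_bounded_sets_eq_relatively_compact_sets:
  assumes "mcomplete"
  shows "totally_bounded_sets = relatively_compact_sets mtopology"
  using mtotally_bounded_eq_compact_closure_of[OF assms]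
  by (simp add: totally_bounded_sets_def relatively_compact_sets_def)

lemma compact_closure_iff_bourbaki_bounded_eq_relatively_compact:
  "(\<forall>B \<in> bourbaki_bounded_sets. compactin mtopology (mtopology closure_of B)) \<longleftrightarrow>
     bourbaki_bounded_sets = relatively_compact_sets mtopology"
proof -
  have "B \<subseteq> topspace mtopology" if "B \<in> bourbaki_bounded_sets" for B
    using that by (simp add: bourbaki_bounded_sets_def)
  then show ?thesis
    using relatively_compact_imp_bourbaki_bounded unfolding relatively_compact_sets_def by blast
qed

end

theorem theorem1p3p8:
  fixes M :: "'a set" and d :: "'a \<Rightarrow> 'a \<Rightarrow> real"
  assumes "Metric_space M d"
  shows "(Metric_space.bourbaki_complete M d \<longleftrightarrow>
            Metric_space.sequentially_bourbaki_complete M d) \<and>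
         (Metric_space.sequentially_bourbaki_complete M d \<longleftrightarrow>
            (\<forall>B \<in> Metric_space.bourbaki_bounded_sets M d.
               compactin (Metric_space.mtopology M d) (Metric_space.mtopology M d closure_of B))) \<and>
         ((\<forall>B \<in> Metric_space.bourbaki_bounded_sets M d.
               compactin (Metric_space.mtopology M d) (Metric_space.mtopology M d closure_of B)) \<longleftrightarrow>
            Metric_space.bourbaki_bounded_sets M d =
              relatively_compact_sets (Metric_space.mtopology M d)) \<and>
         (Metric_space.bourbaki_bounded_sets M d =
              relatively_compact_sets (Metric_space.mtopology M d) \<longleftrightarrow>
            Metric_space.mcomplete M d \<and>
            Metric_space.bourbaki_bounded_sets M d = Metric_space.totally_bounded_sets M d)"
proof -
  interpret Metric_space M d by (fact assms)
  have filter_iff_seq: "bourbaki_complete \<longleftrightarrow> sequentially_bourbaki_complete"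
    using bourbaki_complete_imp_sequentially_bourbaki_complete
      sequentially_bourbaki_complete_imp_bourbaki_complete by blast
  have seq_imp_total: "mcomplete \<and> bourbaki_bounded_sets = totally_bounded_sets"
    if "sequentially_bourbaki_complete"
    using that sequentially_bourbaki_complete_imp_mcomplete
      sequentially_bourbaki_complete_imp_totally_bounded by blast
  have total_imp_compact: "bourbaki_bounded_sets = relatively_compact_sets mtopology"
    if "mcomplete \<and> bourbaki_bounded_sets = totally_bounded_sets"
    using that totally_bounded_sets_eq_relatively_compact_sets by simp
  show ?thesis
    using filter_iff_seq seq_imp_total total_imp_compact
      compact_closure_iff_bourbaki_bounded_eq_relatively_compact
      compact_closure_imp_sequentially_bourbaki_complete by argo
qed

end
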